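(* Let $k$ be a field of characteristic $\neq 2$, $G$ a finite group whose order is invertible in $k$, and $A=(A,\cdot)$ a Jordan algebra over $k$. Let $\varphi:G\to\mathrm{Aut}_{\rm J}(A)$ be a group morphism (an action of $G$ on $A$). Let $A^G:=\{a\in A\mid\varphi(g)(a)=a\ \text{for all }g\in G\}\subseteq A$ be the corresponding subalgebra of invariants and $V$ a complement of $A^G$ in $A$. Then there exists a Jordan extending structure of $A^G$ through $V$ with trivial $\triangleright$, with associated twisted product $A^G\,\#^{\bullet}\,V$, and an isomorphism of Jordan algebras $A\cong A^G\,\#^{\bullet}\,V$.
   Context: $k$ is a field of characteristic $\neq 2$; all vector spaces and (bi)linear maps are over $k$. A Jordan algebra is a vector space $A$ with a commutative bilinear multiplication satisfying $(a^2\cdot b)\cdot a=a^2\cdot(b\cdot a)$ for all $a,b$ (no unit assumed). $\mathrm{Aut}_{\rm J}(A)$ is the group of Jordan algebra automorphisms of $A$. For a Jordan algebra $B$ and a vector space $V$, a Jordan extending structure of $B$ through $V$ is a system of bilinear maps $\triangleleft:V\times B\to V$, $\triangleright:V\times B\to B$, $f:V\times V\to B$, $\cdot_V:V\times V\to V$ such that $B\times V$ with multiplication $(a,x)\circ(b,y)=(a\cdot b+x\triangleright b+y\triangleright a+f(x,y),\,x\triangleleft b+y\triangleleft a+x\cdot_Vy)$ is a Jordan algebra. When $\triangleright$ is trivial ($x\triangleright b=0$ for all $x\in V$, $b\in B$), the resulting Jordan algebra is called the twisted product of $B$ and $V$ and is denoted $B\,\#^{\bullet}\,V$; its multiplication is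 $$(a,x)\circ(b,y)=\bigl(a\cdot b+f(x,y),\;x\triangleleft b+y\triangleleft a+x\cdot_Vy\bigr).$$ *)

theory Defs
  imports "HOL-Algebra.Module" "HOL-Algebra.Bij" "HOL-Algebra.AbelCoset"
begin

definition ring_characteristic :: "('k, 'm) ring_scheme \<Rightarrow> nat" where
  "ring_characteristic R =
    (if \<exists>n::nat. 0 < n \<and> [n] \<cdot>\<^bsub>R\<^esub> \<one>\<^bsub>R\<^esub> = \<zero>\<^bsub>R\<^esub>
     then LEAST n::nat. 0 < n \<and> [n] \<cdot>\<^bsub>R\<^esub> \<one>\<^bsub>R\<^esub> = \<zero>\<^bsub>R\<^esub>
     else 0)"

text \<open>
  A vector space is a module record over a field; of its fields only the carrier, the addition,
  the zero and the scalar multiplication matter. A Jordan algebra uses in addition the field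
  \<open>mult\<close> as its product. The field \<open>one\<close> is never constrained, since no unit is assumed.
\<close>

locale linear_space = field K + module K V
  for K :: "('k, 'm) ring_scheme" (structure) and V :: "('k, 'v, 'n) module_scheme" (structure)

locale jordan_algebra = linear_space K A
  for K :: "('k, 'm) ring_scheme" (structure) and A :: "('k, 'a, 'n) module_scheme" (structure) +
  assumes jmult_closed:
      "\<lbrakk>a \<in> carrier A; b \<in> carrier A\<rbrakk> \<Longrightarrow> a \<otimes>\<^bsub>A\<^esub> b \<in> carrier A"
    and jmult_comm:
      "\<lbrakk>a \<in> carrier A; b \<in> carrier A\<rbrakk> \<Longrightarrow> a \<otimes>\<^bsub>A\<^esub> b = b \<otimes>\<^bsub>A\<^esub> a"
    and jmult_l_distr:
      "\<lbrakk>a \<in> carrier A; b \<in> carrier A; c \<in> carrier A\<rbrakk>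
        \<Longrightarrow> (a \<oplus>\<^bsub>A\<^esub> b) \<otimes>\<^bsub>A\<^esub> c = a \<otimes>\<^bsub>A\<^esub> c \<oplus>\<^bsub>A\<^esub> b \<otimes>\<^bsub>A\<^esub> c"
    and jmult_r_distr:
      "\<lbrakk>a \<in> carrier A; b \<in> carrier A; c \<in> carrier A\<rbrakk>
        \<Longrightarrow> a \<otimes>\<^bsub>A\<^esub> (b \<oplus>\<^bsub>A\<^esub> c) = a \<otimes>\<^bsub>A\<^esub> b \<oplus>\<^bsub>A\<^esub> a \<otimes>\<^bsub>A\<^esub> c"
    and jmult_smult_l:
      "\<lbrakk>r \<in> carrier K; a \<in> carrier A; b \<in> carrier A\<rbrakk>
        \<Longrightarrow> (r \<odot>\<^bsub>A\<^esub> a) \<otimes>\<^bsub>A\<^esub> b = r \<odot>\<^bsub>A\<^esub> (a \<otimes>\<^bsub>A\<^esub> b)"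
    and jmult_smult_r:
      "\<lbrakk>r \<in> carrier K; a \<in> carrier A; b \<in> carrier A\<rbrakk>
        \<Longrightarrow> a \<otimes>\<^bsub>A\<^esub> (r \<odot>\<^bsub>A\<^esub> b) = r \<odot>\<^bsub>A\<^esub> (a \<otimes>\<^bsub>A\<^esub> b)"
    and jordan_identity:
      "\<lbrakk>a \<in> carrier A; b \<in> carrier A\<rbrakk>
        \<Longrightarrow> ((a \<otimes>\<^bsub>A\<^esub> a) \<otimes>\<^bsub>A\<^esub> b) \<otimes>\<^bsub>A\<^esub> a = (a \<otimes>\<^bsub>A\<^esub> a) \<otimes>\<^bsub>A\<^esub> (b \<otimes>\<^bsub>A\<^esub> a)"

definition jordan_hom ::
  "('k, 'm) ring_scheme \<Rightarrow> ('k, 'a, 'n) module_scheme \<Rightarrow> ('k, 'b, 'p) module_scheme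
    \<Rightarrow> ('a \<Rightarrow> 'b) set" where
  "jordan_hom K A B =
    {h \<in> carrier A \<rightarrow> carrier B.
      (\<forall>x\<in>carrier A. \<forall>y\<in>carrier A. h (x \<oplus>\<^bsub>A\<^esub> y) = h x \<oplus>\<^bsub>B\<^esub> h y) \<and>
      (\<forall>r\<in>carrier K. \<forall>x\<in>carrier A. h (r \<odot>\<^bsub>A\<^esub> x) = r \<odot>\<^bsub>B\<^esub> h x) \<and>
      (\<forall>x\<in>carrier A. \<forall>y\<in>carrier A. h (x \<otimes>\<^bsub>A\<^esub> y) = h x \<otimes>\<^bsub>B\<^esub> h y)}"

definition jordan_iso ::
  "('k, 'm) ring_scheme \<Rightarrow> ('k, 'a, 'n) module_scheme \<Rightarrow> ('k, 'b, 'p) module_scheme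
    \<Rightarrow> ('a \<Rightarrow> 'b) set" where
  "jordan_iso K A B = {h \<in> jordan_hom K A B. bij_betw h (carrier A) (carrier B)}"

definition jordan_auto ::
  "('k, 'm) ring_scheme \<Rightarrow> ('k, 'a, 'n) module_scheme \<Rightarrow> ('a \<Rightarrow> 'a) set" where
  "jordan_auto K A = jordan_hom K A A \<inter> Bij (carrier A)"

definition Jordan_AutoGroup ::
  "('k, 'm) ring_scheme \<Rightarrow> ('k, 'a, 'n) module_scheme \<Rightarrow> ('a \<Rightarrow> 'a) monoid" where
  "Jordan_AutoGroup K A = BijGroup (carrier A) \<lparr>carrier := jordan_auto K A\<rparr>"

definition invariants ::
  "('g, 'q) monoid_scheme \<Rightarrow> ('g \<Rightarrow> 'a \<Rightarrow> 'a) \<Rightarrow> ('k, 'a, 'n) module_scheme \<Rightarrow> 'a set" where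
  "invariants G \<phi> A = {a \<in> carrier A. \<forall>g\<in>carrier G. \<phi> g a = a}"

definition is_complement ::
  "('k, 'm) ring_scheme \<Rightarrow> ('k, 'a, 'n) module_scheme \<Rightarrow> 'a set \<Rightarrow> 'a set \<Rightarrow> bool" where
  "is_complement K A U W \<longleftrightarrow>
    submodule W K A \<and> U \<inter> W = {\<zero>\<^bsub>A\<^esub>} \<and> U <+>\<^bsub>A\<^esub> W = carrier A"

definition bilinear_map ::
  "('k, 'm) ring_scheme \<Rightarrow> ('k, 'u, 'n) module_scheme \<Rightarrow> ('k, 'v, 'p) module_scheme
    \<Rightarrow> ('k, 'w, 'q) module_scheme \<Rightarrow> ('u \<Rightarrow> 'v \<Rightarrow> 'w) \<Rightarrow> bool" where
  "bilinear_map K U V W h \<longleftrightarrow>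
    h \<in> carrier U \<rightarrow> carrier V \<rightarrow> carrier W \<and>
    (\<forall>x\<in>carrier U. \<forall>x'\<in>carrier U. \<forall>y\<in>carrier V. h (x \<oplus>\<^bsub>U\<^esub> x') y = h x y \<oplus>\<^bsub>W\<^esub> h x' y) \<and>
    (\<forall>x\<in>carrier U. \<forall>y\<in>carrier V. \<forall>y'\<in>carrier V. h x (y \<oplus>\<^bsub>V\<^esub> y') = h x y \<oplus>\<^bsub>W\<^esub> h x y') \<and>
    (\<forall>r\<in>carrier K. \<forall>x\<in>carrier U. \<forall>y\<in>carrier V. h (r \<odot>\<^bsub>U\<^esub> x) y = r \<odot>\<^bsub>W\<^esub> h x y) \<and>
    (\<forall>r\<in>carrier K. \<forall>x\<in>carrier U. \<forall>y\<in>carrier V. h x (r \<odot>\<^bsub>V\<^esub> y) = r \<odot>\<^bsub>W\<^esub> h x y)"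

text \<open>
  Throughout, \<open>ra\<close> is the map \<open>\<triangleleft> : V \<times> B \<rightarrow> V\<close>, \<open>la\<close> is \<open>\<triangleright> : V \<times> B \<rightarrow> B\<close>, \<open>f : V \<times> V \<rightarrow> B\<close>
  and \<open>mV : V \<times> V \<rightarrow> V\<close> is the product on \<open>V\<close>; the fields \<open>mult\<close> and \<open>one\<close> of the record \<open>V\<close>
  are not used.
\<close>

definition unified_product ::
  "('k, 'b, 'n) module_scheme \<Rightarrow> ('k, 'v, 'p) module_scheme
    \<Rightarrow> ('v \<Rightarrow> 'b \<Rightarrow> 'v) \<Rightarrow> ('v \<Rightarrow> 'b \<Rightarrow> 'b) \<Rightarrow> ('v \<Rightarrow> 'v \<Rightarrow> 'b) \<Rightarrow> ('v \<Rightarrow> 'v \<Rightarrow> 'v)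
    \<Rightarrow> ('k, 'b \<times> 'v) module" where
  "unified_product B V ra la f mV =
    \<lparr>carrier = carrier B \<times> carrier V,
     mult = (\<lambda>(a, x) (b, y).
       (a \<otimes>\<^bsub>B\<^esub> b \<oplus>\<^bsub>B\<^esub> la x b \<oplus>\<^bsub>B\<^esub> la y a \<oplus>\<^bsub>B\<^esub> f x y,
        ra x b \<oplus>\<^bsub>V\<^esub> ra y a \<oplus>\<^bsub>V\<^esub> mV x y)),
     one = undefined,
     zero = (\<zero>\<^bsub>B\<^esub>, \<zero>\<^bsub>V\<^esub>),
     add = (\<lambda>(a, x) (b, y). (a \<oplus>\<^bsub>B\<^esub> b, x \<oplus>\<^bsub>V\<^esub> y)),
     smult = (\<lambda>r (a, x). (r \<odot>\<^bsub>B\<^esub> a, r \<odot>\<^bsub>V\<^esub> x))\<rparr>"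

definition jordan_extending_structure ::
  "('k, 'm) ring_scheme \<Rightarrow> ('k, 'b, 'n) module_scheme \<Rightarrow> ('k, 'v, 'p) module_scheme
    \<Rightarrow> ('v \<Rightarrow> 'b \<Rightarrow> 'v) \<Rightarrow> ('v \<Rightarrow> 'b \<Rightarrow> 'b) \<Rightarrow> ('v \<Rightarrow> 'v \<Rightarrow> 'b) \<Rightarrow> ('v \<Rightarrow> 'v \<Rightarrow> 'v)
    \<Rightarrow> bool" where
  "jordan_extending_structure K B V ra la f mV \<longleftrightarrow>
    jordan_algebra K B \<and> linear_space K V \<and>
    bilinear_map K V B V ra \<and> bilinear_map K V B B la \<and>
    bilinear_map K V V B f \<and> bilinear_map K V V V mV \<and>
    jordan_algebra K (unified_product B V ra la f mV)"

definition twisted_product ::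
  "('k, 'b, 'n) module_scheme \<Rightarrow> ('k, 'v, 'p) module_scheme
    \<Rightarrow> ('v \<Rightarrow> 'b \<Rightarrow> 'v) \<Rightarrow> ('v \<Rightarrow> 'v \<Rightarrow> 'b) \<Rightarrow> ('v \<Rightarrow> 'v \<Rightarrow> 'v)
    \<Rightarrow> ('k, 'b \<times> 'v) module" where
  "twisted_product B V ra f mV =
    \<lparr>carrier = carrier B \<times> carrier V,
     mult = (\<lambda>(a, x) (b, y).
       (a \<otimes>\<^bsub>B\<^esub> b \<oplus>\<^bsub>B\<^esub> f x y, ra x b \<oplus>\<^bsub>V\<^esub> ra y a \<oplus>\<^bsub>V\<^esub> mV x y)),
     one = undefined,
     zero = (\<zero>\<^bsub>B\<^esub>, \<zero>\<^bsub>V\<^esub>),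
     add = (\<lambda>(a, x) (b, y). (a \<oplus>\<^bsub>B\<^esub> b, x \<oplus>\<^bsub>V\<^esub> y)),
     smult = (\<lambda>r (a, x). (r \<odot>\<^bsub>B\<^esub> a, r \<odot>\<^bsub>V\<^esub> x))\<rparr>"

lemma unified_product_eq_twisted_product:
  assumes "jordan_extending_structure K B V ra la f mV"
    and "\<forall>x\<in>carrier V. \<forall>b\<in>carrier B. la x b = \<zero>\<^bsub>B\<^esub>"
    and "p \<in> carrier B \<times> carrier V" "q \<in> carrier B \<times> carrier V"
  shows "p \<otimes>\<^bsub>unified_product B V ra la f mV\<^esub> q = p \<otimes>\<^bsub>twisted_product B V ra f mV\<^esub> q"
proof -
  interpret B: jordan_algebra K B
    using assms(1) by (simp add: jordan_extending_structure_def)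
  show ?thesis
    using assms(2-4)
    by (auto simp: unified_product_def twisted_product_def B.jmult_closed)
qed

lemma (in jordan_algebra) group_Jordan_AutoGroup: "group (Jordan_AutoGroup K A)"
proof -
  interpret S: group "BijGroup (carrier A)" by (rule group_BijGroup)
  have inv: "restrict (inv_into (carrier A) h) (carrier A) \<in> jordan_auto K A"
    if h: "h \<in> jordan_auto K A" for h
  proof -
    have hB: "h \<in> Bij (carrier A)" and hh: "h \<in> jordan_hom K A A"
      using h by (auto simp: jordan_auto_def)
    have bij: "bij_betw h (carrier A) (carrier A)" using hB by (simp add: Bij_def)
    let ?i = "inv_into (carrier A) h"
    have cl: "?i x \<in> carrier A" if "x \<in> carrier A" for x
      using Bij_inv_into_mem[OF hB that] .
    have sm: "?i (r \<odot>\<^bsub>A\<^esub> x) = r \<odot>\<^bsub>A\<^esub> ?i x" if "r \<in> carrier K" "x \<in> carrier A" for r x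
    proof -
      have "h (r \<odot>\<^bsub>A\<^esub> ?i x) = r \<odot>\<^bsub>A\<^esub> x"
        using hh that cl bij by (auto simp: jordan_hom_def bij_betw_inv_into_right)
      then show ?thesis
        using that cl bij by (metis bij_betw_inv_into_left smult_closed)
    qed
    show ?thesis
      using hh hB cl sm Bij_inv_into_lemma[of "carrier A" h "mult A"]
        Bij_inv_into_lemma[of "carrier A" h "add A"]
      by (auto simp: jordan_auto_def restrict_inv_into_Bij jordan_hom_def jmult_closed Pi_iff)
  qed
  have "subgroup (jordan_auto K A) (BijGroup (carrier A))"
  proof (rule S.subgroupI)
    show "jordan_auto K A \<subseteq> carrier (BijGroup (carrier A))"
      by (auto simp: jordan_auto_def BijGroup_def)
    have "(\<lambda>x\<in>carrier A. x) \<in> jordan_auto K A"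
      by (auto simp: jordan_auto_def jordan_hom_def id_Bij jmult_closed)
    then show "jordan_auto K A \<noteq> {}" by blast
    show "inv\<^bsub>BijGroup (carrier A)\<^esub> a \<in> jordan_auto K A" if "a \<in> jordan_auto K A" for a
      using inv[OF that] that by (simp add: inv_BijGroup jordan_auto_def)
    show "a \<otimes>\<^bsub>BijGroup (carrier A)\<^esub> b \<in> jordan_auto K A"
      if "a \<in> jordan_auto K A" "b \<in> jordan_auto K A" for a b
      using that compose_Bij[of a "carrier A" b]
      by (auto simp: jordan_auto_def BijGroup_def jordan_hom_def compose_def
          jmult_closed Pi_iff)
  qed
  then show ?thesis
    unfolding Jordan_AutoGroup_def by (rule S.subgroup_imp_group)
qed

end

theory Submission
  imports Defs
begin

text \<open>
  Averaging over \<open>G\<close> gives a linear retraction \<open>t : A \<rightarrow> A\<^sup>G\<close> with \<open>t (a \<cdot> b) = t a \<cdot> b\<close> for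
  \<open>b \<in> A\<^sup>G\<close>. Hence the complement \<open>ker t\<close> of \<open>A\<^sup>G\<close> is stable under multiplication by \<open>A\<^sup>G\<close>, which is
  what makes \<open>\<triangleright>\<close> trivial. The given complement \<open>V\<close> need not be \<open>ker t\<close>, but the projection \<open>p\<close>
  onto \<open>V\<close> along \<open>A\<^sup>G\<close> restricts to a linear isomorphism \<open>ker t \<rightarrow> V\<close> with inverse \<open>x \<mapsto> x - t x\<close>.
  So \<open>a \<mapsto> (t a, p a)\<close> is a linear isomorphism \<open>A \<rightarrow> A\<^sup>G \<times> V\<close>, and transporting the product
  of \<open>A\<close> along it gives the twisted product.
\<close>

section \<open>Transport of structure and subalgebras\<close>

text \<open>Every element of \<open>carrier B\<close> has the form \<open>h a\<close>, and all
  axioms are closure conditions or equations between operations that \<open>h\<close> respects, so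
  each one is the image of the same axiom in \<open>A\<close>. This avoids a direct verification of
  the Jordan identity on pairs.\<close>

lemma (in jordan_algebra) jordan_algebra_transport:
  assumes bij: "bij_betw h (carrier A) (carrier B)"
    and zero: "h \<zero>\<^bsub>A\<^esub> = \<zero>\<^bsub>B\<^esub>"
    and add: "\<And>a b. \<lbrakk>a \<in> carrier A; b \<in> carrier A\<rbrakk> \<Longrightarrow> h (a \<oplus>\<^bsub>A\<^esub> b) = h a \<oplus>\<^bsub>B\<^esub> h b"
    and smult: "\<And>r a. \<lbrakk>r \<in> carrier K; a \<in> carrier A\<rbrakk> \<Longrightarrow> h (r \<odot>\<^bsub>A\<^esub> a) = r \<odot>\<^bsub>B\<^esub> h a"
    and mult: "\<And>a b. \<lbrakk>a \<in> carrier A; b \<in> carrier A\<rbrakk> \<Longrightarrow> h (a \<otimes>\<^bsub>A\<^esub> b) = h a \<otimes>\<^bsub>B\<^esub> h b"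
  shows "jordan_algebra K B"
proof -
  have carrier_B: "carrier B = h ` carrier A"
    using bij by (simp add: bij_betw_def)
  \<comment> \<open>Reversed, these equations pull all operations of \<open>B\<close> inside a
    single \<open>h\<close>, so that a goal over \<open>B\<close> becomes an identity of
    \<open>A\<close> under \<open>h\<close>.\<close>
  note hom = zero[symmetric] add[symmetric] smult[symmetric] mult[symmetric]
  have "abelian_group B"
  proof (rule abelian_groupI)
    fix x assume "x \<in> carrier B"
    then obtain a where a: "a \<in> carrier A" "x = h a" by (auto simp: carrier_B)
    have "h (\<ominus>\<^bsub>A\<^esub> a) \<oplus>\<^bsub>B\<^esub> x = \<zero>\<^bsub>B\<^esub>"
      using a by (simp add: hom M.l_neg)
    then show "\<exists>y\<in>carrier B. y \<oplus>\<^bsub>B\<^esub> x = \<zero>\<^bsub>B\<^esub>"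
      using a by (auto simp: carrier_B)
  qed (auto simp: carrier_B hom M.a_assoc intro!: arg_cong[where f = h] M.a_comm)
  then have "module K B"
    by (rule moduleI[OF is_cring])
      (auto simp: carrier_B hom smult_l_distr smult_r_distr smult_assoc1)
  then have "linear_space K B"
    by (rule linear_space.intro[OF field_axioms])
  then show ?thesis
    by (rule jordan_algebra.intro, unfold_locales)
      (auto simp: carrier_B hom jmult_closed jmult_l_distr jmult_r_distr jmult_smult_l jmult_smult_r
        jordan_identity intro!: arg_cong[where f = h] jmult_comm)
qed

lemma (in jordan_algebra) subalgebra_is_jordan_algebra:
  assumes "submodule B K A"
    and "\<And>a b. \<lbrakk>a \<in> B; b \<in> B\<rbrakk> \<Longrightarrow> a \<otimes>\<^bsub>A\<^esub> b \<in> B"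
  shows "jordan_algebra K (A\<lparr>carrier := B\<rparr>)"
proof -
  have sub: "\<And>b. b \<in> B \<Longrightarrow> b \<in> carrier A"
    using submoduleE(1)[OF assms(1)] by blast
  have "linear_space K (A\<lparr>carrier := B\<rparr>)"
    using submodule.submodule_is_module[OF assms(1) module_axioms]
    by (rule linear_space.intro[OF field_axioms])
  then show ?thesis
    by (rule jordan_algebra.intro, unfold_locales)
      (auto simp: sub assms(2) jmult_l_distr jmult_r_distr jmult_smult_l jmult_smult_r
        jordan_identity intro!: jmult_comm)
qed

section \<open>Projection along a submodule\<close>

text \<open>The condition on the sum gives existence of a \<open>W\<close>-component, the one on the
  intersection its uniqueness, and uniqueness forces linearity.\<close>

lemma (in module) projection_onto_complement:
  assumes U: "submodule U R M" and W: "is_complement R M U W"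
  obtains p where
    "\<And>a. a \<in> carrier M \<Longrightarrow> p a \<in> W"
    "\<And>a. a \<in> carrier M \<Longrightarrow> \<exists>u\<in>U. a = u \<oplus>\<^bsub>M\<^esub> p a"
    "\<And>u. u \<in> U \<Longrightarrow> p u = \<zero>\<^bsub>M\<^esub>"
    "\<And>w. w \<in> W \<Longrightarrow> p w = w"
    "\<And>a b. \<lbrakk>a \<in> carrier M; b \<in> carrier M\<rbrakk> \<Longrightarrow> p (a \<oplus>\<^bsub>M\<^esub> b) = p a \<oplus>\<^bsub>M\<^esub> p b"
    "\<And>r a. \<lbrakk>r \<in> carrier R; a \<in> carrier M\<rbrakk> \<Longrightarrow> p (r \<odot>\<^bsub>M\<^esub> a) = r \<odot>\<^bsub>M\<^esub> p a"
proof -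
  have W': "submodule W R M" and int: "U \<inter> W = {\<zero>\<^bsub>M\<^esub>}" and sum: "U <+>\<^bsub>M\<^esub> W = carrier M"
    using W by (auto simp: is_complement_def)
  note [simp] = submoduleE(3-5)[OF U] submoduleE(3-5)[OF W']
  have sub: "\<And>u. u \<in> U \<Longrightarrow> u \<in> carrier M" "\<And>w. w \<in> W \<Longrightarrow> w \<in> carrier M"
    using submoduleE(1)[OF U] submoduleE(1)[OF W'] by blast+
  have zero: "\<zero>\<^bsub>M\<^esub> \<in> U" "\<zero>\<^bsub>M\<^esub> \<in> W" using int by auto
  have ex: "\<exists>w. w \<in> W \<and> (\<exists>u\<in>U. a = u \<oplus>\<^bsub>M\<^esub> w)" if "a \<in> carrier M" for a
    using that unfolding sum[symmetric] set_add_def' by blast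
  \<comment> \<open>The difference of the two \<open>W\<close>-parts equals, up to sign, that of the
    \<open>U\<close>-parts, so it lies in \<open>U \<inter> W\<close>.\<close>
  have unique: "w = w'" if "u \<in> U" "u' \<in> U" "w \<in> W" "w' \<in> W" "u \<oplus>\<^bsub>M\<^esub> w = u' \<oplus>\<^bsub>M\<^esub> w'" for u u' w w'
  proof -
    have "w \<ominus>\<^bsub>M\<^esub> w' = \<ominus>\<^bsub>M\<^esub> u \<oplus>\<^bsub>M\<^esub> ((u \<oplus>\<^bsub>M\<^esub> w) \<ominus>\<^bsub>M\<^esub> w')"
      using that(1-4) by (simp add: sub a_minus_def M.a_assoc M.r_neg1)
    also have "\<dots> = u' \<ominus>\<^bsub>M\<^esub> u"
      using that by (simp add: sub a_minus_def M.a_assoc M.r_neg M.a_comm[of "\<ominus>\<^bsub>M\<^esub> u"])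
    finally have eq: "w \<ominus>\<^bsub>M\<^esub> w' = u' \<ominus>\<^bsub>M\<^esub> u" .
    moreover have "w \<ominus>\<^bsub>M\<^esub> w' \<in> W" "u' \<ominus>\<^bsub>M\<^esub> u \<in> U"
      using that by (simp_all add: a_minus_def)
    ultimately have "w \<ominus>\<^bsub>M\<^esub> w' \<in> U \<inter> W" by simp
    then have "w \<ominus>\<^bsub>M\<^esub> w' = \<zero>\<^bsub>M\<^esub>" unfolding int by simp
    then show ?thesis
      using M.minus_equality[of w "\<ominus>\<^bsub>M\<^esub> w'"] that(3,4) by (simp add: sub a_minus_def)
  qed
  define p where "p a = (SOME w. w \<in> W \<and> (\<exists>u\<in>U. a = u \<oplus>\<^bsub>M\<^esub> w))" for a
  have p: "p a \<in> W" "\<exists>u\<in>U. a = u \<oplus>\<^bsub>M\<^esub> p a" if "a \<in> carrier M" for a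
    using someI_ex[OF ex[OF that]] unfolding p_def by auto
  \<comment> \<open>By \<open>unique\<close>, the chosen component is the only possible one.
    Linearity follows by exhibiting a decomposition of the sum or multiple and reading off its
    \<open>W\<close>-part.\<close>
  have p_eq: "p (u \<oplus>\<^bsub>M\<^esub> w) = w" if "u \<in> U" "w \<in> W" for u w
    using p[of "u \<oplus>\<^bsub>M\<^esub> w"] unique that sub by (metis M.a_closed)
  show thesis
  proof (rule that)
    show "p u = \<zero>\<^bsub>M\<^esub>" if "u \<in> U" for u
      using p_eq[OF that zero(2)] that by (simp add: sub)
    show "p w = w" if "w \<in> W" for w
      using p_eq[OF zero(1) that] that by (simp add: sub)
  next
    fix a b assume ab: "a \<in> carrier M" "b \<in> carrier M"
    obtain u v where uv: "u \<in> U" "a = u \<oplus>\<^bsub>M\<^esub> p a" "v \<in> U" "b = v \<oplus>\<^bsub>M\<^esub> p b"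
      using p(2) ab by blast
    have "a \<oplus>\<^bsub>M\<^esub> b = (u \<oplus>\<^bsub>M\<^esub> p a) \<oplus>\<^bsub>M\<^esub> (v \<oplus>\<^bsub>M\<^esub> p b)"
      using uv by simp
    also have "\<dots> = (u \<oplus>\<^bsub>M\<^esub> v) \<oplus>\<^bsub>M\<^esub> (p a \<oplus>\<^bsub>M\<^esub> p b)"
      using uv(1,3) ab p(1) by (simp add: sub M.a_ac)
    finally show "p (a \<oplus>\<^bsub>M\<^esub> b) = p a \<oplus>\<^bsub>M\<^esub> p b"
      using uv(1,3) ab p(1) by (simp add: p_eq)
  next
    fix r a assume ra: "r \<in> carrier R" "a \<in> carrier M"
    obtain u where u: "u \<in> U" "a = u \<oplus>\<^bsub>M\<^esub> p a"
      using p(2) ra by blast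
    have "r \<odot>\<^bsub>M\<^esub> a = r \<odot>\<^bsub>M\<^esub> (u \<oplus>\<^bsub>M\<^esub> p a)"
      using u by simp
    also have "\<dots> = r \<odot>\<^bsub>M\<^esub> u \<oplus>\<^bsub>M\<^esub> r \<odot>\<^bsub>M\<^esub> p a"
      using u(1) ra p(1) by (simp add: sub smult_r_distr)
    finally show "p (r \<odot>\<^bsub>M\<^esub> a) = r \<odot>\<^bsub>M\<^esub> p a"
      using u(1) ra p(1) by (simp add: p_eq)
  qed (use p in auto)
qed

section \<open>From a \<open>B\<close>-linear retraction to a twisted product\<close>

text \<open>This is the part of the argument free of groups: any linear retraction \<open>t\<close>
  onto a subalgebra \<open>B\<close> that also commutes with multiplication by \<open>B\<close>
  yields the decomposition.\<close>

lemma (in jordan_algebra) twisted_product_of_retraction: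
  assumes B: "submodule B K A"
    and B_mult: "\<And>a b. \<lbrakk>a \<in> B; b \<in> B\<rbrakk> \<Longrightarrow> a \<otimes>\<^bsub>A\<^esub> b \<in> B"
    and V: "is_complement K A B V"
    and t_closed: "\<And>a. a \<in> carrier A \<Longrightarrow> t a \<in> B"
    and t_id: "\<And>b. b \<in> B \<Longrightarrow> t b = b"
    and t_add: "\<And>a b. \<lbrakk>a \<in> carrier A; b \<in> carrier A\<rbrakk> \<Longrightarrow> t (a \<oplus>\<^bsub>A\<^esub> b) = t a \<oplus>\<^bsub>A\<^esub> t b"
    and t_smult: "\<And>r a. \<lbrakk>r \<in> carrier K; a \<in> carrier A\<rbrakk> \<Longrightarrow> t (r \<odot>\<^bsub>A\<^esub> a) = r \<odot>\<^bsub>A\<^esub> t a"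
    and t_mult: "\<And>a b. \<lbrakk>a \<in> carrier A; b \<in> B\<rbrakk> \<Longrightarrow> t (a \<otimes>\<^bsub>A\<^esub> b) = t a \<otimes>\<^bsub>A\<^esub> b"
  shows "\<exists>ra la f mV.
      jordan_extending_structure K (A\<lparr>carrier := B\<rparr>) (A\<lparr>carrier := V\<rparr>) ra la f mV \<and>
      (\<forall>x\<in>V. \<forall>b\<in>B. la x b = \<zero>\<^bsub>A\<^esub>) \<and>
      jordan_iso K A (twisted_product (A\<lparr>carrier := B\<rparr>) (A\<lparr>carrier := V\<rparr>) ra f mV) \<noteq> {}"
proof -
  have V': "submodule V K A" using V by (simp add: is_complement_def)
  obtain p where p_closed: "\<And>a. a \<in> carrier A \<Longrightarrow> p a \<in> V"
    and p_decomp: "\<And>a. a \<in> carrier A \<Longrightarrow> \<exists>u\<in>B. a = u \<oplus>\<^bsub>A\<^esub> p a"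
    and p_B: "\<And>u. u \<in> B \<Longrightarrow> p u = \<zero>\<^bsub>A\<^esub>"
    and p_V: "\<And>w. w \<in> V \<Longrightarrow> p w = w"
    and p_add: "\<And>a b. \<lbrakk>a \<in> carrier A; b \<in> carrier A\<rbrakk> \<Longrightarrow> p (a \<oplus>\<^bsub>A\<^esub> b) = p a \<oplus>\<^bsub>A\<^esub> p b"
    and p_smult: "\<And>r a. \<lbrakk>r \<in> carrier K; a \<in> carrier A\<rbrakk> \<Longrightarrow> p (r \<odot>\<^bsub>A\<^esub> a) = r \<odot>\<^bsub>A\<^esub> p a"
    using projection_onto_complement[OF B V] by blast
  have sub: "\<And>b. b \<in> B \<Longrightarrow> b \<in> carrier A" "\<And>x. x \<in> V \<Longrightarrow> x \<in> carrier A"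
    using submoduleE(1)[OF B] submoduleE(1)[OF V'] by blast+
  have B_neg: "\<And>b. b \<in> B \<Longrightarrow> \<ominus>\<^bsub>A\<^esub> b \<in> B"
    using submoduleE(3)[OF B] .
  have B_zero: "\<zero>\<^bsub>A\<^esub> \<in> B"
    using V by (auto simp: is_complement_def)
  \<comment> \<open>\<open>s\<close> is the projection onto the kernel of \<open>t\<close> along
    \<open>B\<close>; by \<open>t_s\<close> and \<open>p_s\<close> it embeds \<open>V\<close> into
    that kernel as a section of \<open>p\<close>.\<close>
  define s where "s x = x \<oplus>\<^bsub>A\<^esub> \<ominus>\<^bsub>A\<^esub> t x" for x
  have tc: "\<And>a. a \<in> carrier A \<Longrightarrow> t a \<in> carrier A" and pc: "\<And>a. a \<in> carrier A \<Longrightarrow> p a \<in> carrier A"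
    using t_closed p_closed sub by blast+
  have sc: "s x \<in> carrier A" if "x \<in> carrier A" for x
    using that by (simp add: s_def tc)
  have t_s: "t (s x) = \<zero>\<^bsub>A\<^esub>" if "x \<in> carrier A" for x
    using that by (simp add: s_def t_add tc t_id t_closed B_neg M.r_neg)
  have p_s: "p (s x) = x" if "x \<in> V" for x
    using that by (simp add: s_def sub p_add tc p_B t_closed B_neg p_V)
  have s_add: "s (x \<oplus>\<^bsub>A\<^esub> y) = s x \<oplus>\<^bsub>A\<^esub> s y" if "x \<in> carrier A" "y \<in> carrier A" for x y
    using that by (simp add: s_def t_add tc M.minus_add M.a_ac)
  have s_smult: "s (r \<odot>\<^bsub>A\<^esub> x) = r \<odot>\<^bsub>A\<^esub> s x" if "r \<in> carrier K" "x \<in> carrier A" for r x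
    using that by (simp add: s_def t_smult tc smult_r_distr smult_r_minus)
  have decomp: "a = t a \<oplus>\<^bsub>A\<^esub> s (p a)" if a: "a \<in> carrier A" for a
  proof -
    obtain u where u: "u \<in> B" "a = u \<oplus>\<^bsub>A\<^esub> p a" using p_decomp[OF a] by blast
    \<comment> \<open>Applying \<open>t\<close> to the decomposition expresses \<open>u\<close> as
      \<open>t a\<close> minus \<open>t (p a)\<close>, which is exactly the correction built into
      \<open>s (p a)\<close>.\<close>
    have "t a = u \<oplus>\<^bsub>A\<^esub> t (p a)"
      using u a t_add[of u "p a"] by (simp add: sub pc t_id)
    then have "t a \<oplus>\<^bsub>A\<^esub> s (p a) = u \<oplus>\<^bsub>A\<^esub> (t (p a) \<oplus>\<^bsub>A\<^esub> (\<ominus>\<^bsub>A\<^esub> t (p a) \<oplus>\<^bsub>A\<^esub> p a))"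
      using u(1) a by (simp add: s_def sub pc tc M.a_assoc M.a_comm[of "p a"])
    also have "\<dots> = a"
      using u a by (simp add: sub pc tc M.r_neg2)
    finally show ?thesis by simp
  qed

  \<comment> \<open>The structure maps are the coordinates under \<open>(t, p)\<close> of products
    in \<open>A\<close>, with each \<open>x\<close> in \<open>V\<close> replaced by its copy
    \<open>s x\<close> in the kernel of \<open>t\<close>. The coordinate \<open>t\<close> of
    \<open>s x\<close> times \<open>b\<close> vanishes, hence \<open>la\<close> is zero.\<close>
  define ra where "ra x b = p (s x \<otimes>\<^bsub>A\<^esub> b)" for x b
  define la where "la x b = \<zero>\<^bsub>A\<^esub>" for x b :: 'a
  define f where "f x y = t (s x \<otimes>\<^bsub>A\<^esub> s y)" for x y
  define mV where "mV x y = p (s x \<otimes>\<^bsub>A\<^esub> s y)" for x y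
  let ?B = "A\<lparr>carrier := B\<rparr>" and ?V = "A\<lparr>carrier := V\<rparr>"
  let ?U = "unified_product ?B ?V ra la f mV" and ?T = "twisted_product ?B ?V ra f mV"
  define h where "h a = (t a, p a)" for a

  have t_prod: "t (a \<otimes>\<^bsub>A\<^esub> b) = t a \<otimes>\<^bsub>A\<^esub> t b \<oplus>\<^bsub>A\<^esub> f (p a) (p b)"
    and p_prod: "p (a \<otimes>\<^bsub>A\<^esub> b) = ra (p a) (t b) \<oplus>\<^bsub>A\<^esub> ra (p b) (t a) \<oplus>\<^bsub>A\<^esub> mV (p a) (p b)"
    if ab: "a \<in> carrier A" "b \<in> carrier A" for a b
  proof -
    let ?x = "s (p a)" and ?y = "s (p b)"
    have c: "?x \<in> carrier A" "?y \<in> carrier A" "t a \<in> carrier A" "t b \<in> carrier A"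
      using ab by (auto simp: sc pc tc)
    have "a \<otimes>\<^bsub>A\<^esub> b = (t a \<oplus>\<^bsub>A\<^esub> ?x) \<otimes>\<^bsub>A\<^esub> (t b \<oplus>\<^bsub>A\<^esub> ?y)"
      using decomp ab by metis
    \<comment> \<open>Commutativity puts the factor from \<open>B\<close> on the right in both mixed
      terms, the form in which \<open>ra\<close> and \<open>t_mult\<close> apply.\<close>
    also have "\<dots> = t a \<otimes>\<^bsub>A\<^esub> t b \<oplus>\<^bsub>A\<^esub> (?x \<otimes>\<^bsub>A\<^esub> t b \<oplus>\<^bsub>A\<^esub> (?y \<otimes>\<^bsub>A\<^esub> t a \<oplus>\<^bsub>A\<^esub> ?x \<otimes>\<^bsub>A\<^esub> ?y))"
      using c by (simp add: jmult_l_distr jmult_r_distr jmult_closed M.a_ac jmult_comm[of ?y "t a"])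
    finally have *: "a \<otimes>\<^bsub>A\<^esub> b = \<dots>" .
    show "t (a \<otimes>\<^bsub>A\<^esub> b) = t a \<otimes>\<^bsub>A\<^esub> t b \<oplus>\<^bsub>A\<^esub> f (p a) (p b)"
    proof -
      \<comment> \<open>Absorption by zero is not an axiom of the locale; it comes from homogeneity,
        with zero written as the scalar zero times \<open>z\<close>.\<close>
      have null: "\<zero>\<^bsub>A\<^esub> \<otimes>\<^bsub>A\<^esub> z = \<zero>\<^bsub>A\<^esub>" if "z \<in> carrier A" for z
        using jmult_smult_l[of "\<zero>\<^bsub>K\<^esub>" z z] that by (simp add: jmult_closed)
      \<comment> \<open>The mixed terms vanish: \<open>t\<close> passes over the factor from
        \<open>B\<close> and kills \<open>s (p a)\<close> and \<open>s (p b)\<close>.\<close>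
      show ?thesis
        unfolding * f_def using ab c
        by (simp add: t_add t_mult t_id t_closed t_s B_mult jmult_closed null pc tc)
    qed
    \<comment> \<open>Only the product of \<open>t a\<close> and \<open>t b\<close> is lost: it lies
      in the subalgebra \<open>B\<close>, where \<open>p\<close> is zero.\<close>
    show "p (a \<otimes>\<^bsub>A\<^esub> b) = ra (p a) (t b) \<oplus>\<^bsub>A\<^esub> ra (p b) (t a) \<oplus>\<^bsub>A\<^esub> mV (p a) (p b)"
      unfolding * ra_def mV_def using ab c
      by (simp add: p_add p_B t_closed B_mult jmult_closed M.a_assoc pc)
  qed

  have bij: "bij_betw h (carrier A) (B \<times> V)"
  \<comment> \<open>The inverse reassembles an element from its component in \<open>B\<close> and
    its component in the kernel of \<open>t\<close>, as in \<open>decomp\<close>.\<close>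
  proof (rule bij_betw_byWitness[where f' = "\<lambda>(b, x). b \<oplus>\<^bsub>A\<^esub> s x"])
    show "\<forall>a\<in>carrier A. (\<lambda>(b, x). b \<oplus>\<^bsub>A\<^esub> s x) (h a) = a"
      using decomp by (simp add: h_def)
    show "\<forall>z\<in>B \<times> V. h ((\<lambda>(b, x). b \<oplus>\<^bsub>A\<^esub> s x) z) = z"
      by (auto simp: h_def t_add p_add sub sc t_id t_s p_B p_s)
  qed (auto simp: h_def t_closed p_closed sub sc)

  have "jordan_algebra K ?U"
  \<comment> \<open>By \<open>t_prod\<close> and \<open>p_prod\<close>, \<open>h\<close> carries the
    product of \<open>A\<close> to that of \<open>?U\<close>, the two \<open>la\<close> terms being
    zero.\<close>
  proof (rule jordan_algebra_transport)
    show "bij_betw h (carrier A) (carrier ?U)"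
      using bij by (simp add: unified_product_def)
  qed (auto simp: h_def unified_product_def t_id p_B B_zero t_add p_add t_smult p_smult t_prod
      p_prod la_def tc jmult_closed)
  moreover have "linear_space K ?V"
    using submodule.submodule_is_module[OF V' module_axioms]
    by (rule linear_space.intro[OF field_axioms])
  moreover have "bilinear_map K ?V ?B ?V ra" "bilinear_map K ?V ?B ?B la"
    "bilinear_map K ?V ?V ?B f" "bilinear_map K ?V ?V ?V mV"
    by (auto simp: bilinear_map_def ra_def la_def f_def mV_def sub sc jmult_closed p_closed t_closed
        s_add s_smult jmult_l_distr jmult_r_distr jmult_smult_l jmult_smult_r p_add p_smult
        t_add t_smult B_zero)
  ultimately have "jordan_extending_structure K ?B ?V ra la f mV"
    using subalgebra_is_jordan_algebra[OF B B_mult]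
    by (simp add: jordan_extending_structure_def)
  moreover have "h \<in> jordan_iso K A ?T"
    using bij by (auto simp: jordan_iso_def jordan_hom_def twisted_product_def h_def t_closed
        p_closed t_add p_add t_smult p_smult t_prod p_prod)
  ultimately show ?thesis
    by (metis empty_iff la_def)
qed

section \<open>Finite sums, group actions and averaging\<close>

text \<open>Stated for merely additive maps, so that it serves both for the action of a group
  element and for multiplication by a fixed invariant.\<close>

lemma (in abelian_group) additive_finsum:
  assumes "finite S" "g \<in> S \<rightarrow> carrier G"
    and u: "\<And>x. x \<in> carrier G \<Longrightarrow> u x \<in> carrier G"
    and add: "\<And>x y. \<lbrakk>x \<in> carrier G; y \<in> carrier G\<rbrakk> \<Longrightarrow> u (x \<oplus> y) = u x \<oplus> u y"
  shows "u (\<Oplus>i\<in>S. g i) = (\<Oplus>i\<in>S. u (g i))"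
  using assms(1,2)
proof (induction set: finite)
  case empty
  have "u \<zero> \<oplus> u \<zero> = u \<zero>" using add[of \<zero> \<zero>] by simp
  then show ?case using u[of \<zero>] by (simp add: add.l_cancel_one')
next
  case (insert i S)
  then show ?case by (simp add: Pi_iff u add)
qed

text \<open>Turns a sum of \<open>n\<close> equal terms into a scalar multiple, so that the inverse
  of the group order in \<open>K\<close> can cancel it.\<close>

lemma (in module) add_pow_eq_smult:
  assumes "x \<in> carrier M"
  shows "[(n::nat)] \<cdot>\<^bsub>M\<^esub> x = ([n] \<cdot>\<^bsub>R\<^esub> \<one>\<^bsub>R\<^esub>) \<odot>\<^bsub>M\<^esub> x"
  using assms by (induction n) (simp_all add: smult_l_distr)

locale jordan_action = jordan_algebra K A + G: group G
  for K :: "('k, 'm) ring_scheme" (structure) and A :: "('k, 'a, 'n) module_scheme" (structure)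
    and G :: "('g, 'q) monoid_scheme" and \<phi> :: "'g \<Rightarrow> 'a \<Rightarrow> 'a" +
  assumes hom: "\<phi> \<in> hom G (Jordan_AutoGroup K A)"
    and finite_G: "finite (carrier G)"
    and order_unit: "[order G] \<cdot>\<^bsub>K\<^esub> \<one>\<^bsub>K\<^esub> \<in> Units K"
begin

lemma action_jordan_auto: "g \<in> carrier G \<Longrightarrow> \<phi> g \<in> jordan_auto K A"
  using hom by (auto simp: hom_def Jordan_AutoGroup_def)

lemma
  assumes "g \<in> carrier G"
  shows action_closed: "a \<in> carrier A \<Longrightarrow> \<phi> g a \<in> carrier A"
    and action_add: "\<lbrakk>a \<in> carrier A; b \<in> carrier A\<rbrakk> \<Longrightarrow> \<phi> g (a \<oplus>\<^bsub>A\<^esub> b) = \<phi> g a \<oplus>\<^bsub>A\<^esub> \<phi> g b"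
    and action_smult: "\<lbrakk>r \<in> carrier K; a \<in> carrier A\<rbrakk> \<Longrightarrow> \<phi> g (r \<odot>\<^bsub>A\<^esub> a) = r \<odot>\<^bsub>A\<^esub> \<phi> g a"
    and action_mult: "\<lbrakk>a \<in> carrier A; b \<in> carrier A\<rbrakk> \<Longrightarrow> \<phi> g (a \<otimes>\<^bsub>A\<^esub> b) = \<phi> g a \<otimes>\<^bsub>A\<^esub> \<phi> g b"
  using action_jordan_auto[OF assms] by (auto simp: jordan_auto_def jordan_hom_def)

lemma action_comp:
  assumes "g \<in> carrier G" "g' \<in> carrier G" "a \<in> carrier A"
  shows "\<phi> (g \<otimes>\<^bsub>G\<^esub> g') a = \<phi> g (\<phi> g' a)"
proof -
  have "\<phi> (g \<otimes>\<^bsub>G\<^esub> g') = \<phi> g \<otimes>\<^bsub>BijGroup (carrier A)\<^esub> \<phi> g'"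
    using hom assms by (simp add: hom_def Jordan_AutoGroup_def)
  \<comment> \<open>The product of \<open>BijGroup\<close> is composition only for arguments in
    \<open>Bij\<close>, and that composition is restricted to \<open>carrier A\<close>.\<close>
  moreover have "\<phi> g \<in> Bij (carrier A)" "\<phi> g' \<in> Bij (carrier A)"
    using action_jordan_auto assms by (auto simp: jordan_auto_def)
  ultimately show ?thesis
    using assms by (simp add: BijGroup_def compose_def)
qed

lemma submodule_invariants: "submodule (invariants G \<phi> A) K A"
proof (rule submoduleI)
  show "\<zero>\<^bsub>A\<^esub> \<in> invariants G \<phi> A"
    using action_smult[of _ "\<zero>\<^bsub>K\<^esub>" "\<zero>\<^bsub>A\<^esub>"] by (simp add: invariants_def action_closed)
  show smult: "r \<odot>\<^bsub>A\<^esub> a \<in> invariants G \<phi> A" if "r \<in> carrier K" "a \<in> invariants G \<phi> A" for r a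
    using that by (simp add: invariants_def action_smult)
  \<comment> \<open>Negatives are treated as multiples by minus one, just as zero above is a
    multiple by the scalar zero; the action is known to respect scalars.\<close>
  show "\<ominus>\<^bsub>A\<^esub> a \<in> invariants G \<phi> A" if "a \<in> invariants G \<phi> A" for a
    using smult[of "\<ominus>\<^bsub>K\<^esub> \<one>\<^bsub>K\<^esub>" a] that by (simp add: invariants_def smult_l_minus)
qed (auto simp: invariants_def action_add)

lemma invariants_mult_closed:
  "\<lbrakk>a \<in> invariants G \<phi> A; b \<in> invariants G \<phi> A\<rbrakk> \<Longrightarrow> a \<otimes>\<^bsub>A\<^esub> b \<in> invariants G \<phi> A"
  by (simp add: invariants_def action_mult jmult_closed)

text \<open>This is the retraction to be used as \<open>t\<close>; the lemmas that follow check the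
  hypotheses of \<open>twisted_product_of_retraction\<close> for it.\<close>

definition reynolds :: "'a \<Rightarrow> 'a" where
  "reynolds a = inv\<^bsub>K\<^esub> ([order G] \<cdot>\<^bsub>K\<^esub> \<one>\<^bsub>K\<^esub>) \<odot>\<^bsub>A\<^esub> (\<Oplus>\<^bsub>A\<^esub>g\<in>carrier G. \<phi> g a)"

lemma orbit_sum_closed: "a \<in> carrier A \<Longrightarrow> (\<Oplus>\<^bsub>A\<^esub>g\<in>carrier G. \<phi> g a) \<in> carrier A"
  by (simp add: action_closed)

lemma inv_order_closed: "inv\<^bsub>K\<^esub> ([order G] \<cdot>\<^bsub>K\<^esub> \<one>\<^bsub>K\<^esub>) \<in> carrier K"
  using order_unit by (rule Units_inv_closed)

text \<open>Left translation by \<open>h\<close> permutes the group, so \<open>\<phi> h\<close> only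
  permutes the summands of the orbit sum.\<close>

lemma reynolds_closed:
  assumes a: "a \<in> carrier A"
  shows "reynolds a \<in> invariants G \<phi> A"
proof -
  let ?S = "\<Oplus>\<^bsub>A\<^esub>g\<in>carrier G. \<phi> g a"
  have "\<phi> h ?S = ?S" if h: "h \<in> carrier G" for h
  proof -
    have "\<phi> h ?S = (\<Oplus>\<^bsub>A\<^esub>g\<in>carrier G. \<phi> h (\<phi> g a))"
      using a h by (intro M.additive_finsum) (auto simp: finite_G action_closed action_add)
    also have "\<dots> = (\<Oplus>\<^bsub>A\<^esub>g\<in>carrier G. \<phi> (h \<otimes>\<^bsub>G\<^esub> g) a)"
      using a h by (intro M.finsum_cong') (auto simp: action_comp action_closed)
    also have "\<dots> = (\<Oplus>\<^bsub>A\<^esub>g\<in>(\<lambda>g. h \<otimes>\<^bsub>G\<^esub> g) ` carrier G. \<phi> g a)"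
      using a h by (intro M.finsum_reindex[symmetric]) (auto simp: action_closed inj_on_def)
    also have "(\<lambda>g. h \<otimes>\<^bsub>G\<^esub> g) ` carrier G = carrier G"
      using h by (rule G.surj_const_mult)
    finally show ?thesis .
  qed
  then show ?thesis
    using a inv_order_closed orbit_sum_closed
    by (simp add: reynolds_def invariants_def action_smult)
qed

text \<open>All summands equal \<open>b\<close>, and their number cancels against the normalising
  scalar.\<close>

lemma reynolds_id:
  assumes b: "b \<in> invariants G \<phi> A"
  shows "reynolds b = b"
proof -
  have bA: "b \<in> carrier A" using b by (simp add: invariants_def)
  have "(\<Oplus>\<^bsub>A\<^esub>g\<in>carrier G. \<phi> g b) = (\<Oplus>\<^bsub>A\<^esub>g\<in>carrier G. b)"
    using b by (intro M.finsum_cong') (auto simp: invariants_def)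
  also have "\<dots> = [order G] \<cdot>\<^bsub>A\<^esub> b"
    using M.add.finprod_const[OF bA, of "carrier G"] by (simp add: order_def)
  also have "\<dots> = ([order G] \<cdot>\<^bsub>K\<^esub> \<one>\<^bsub>K\<^esub>) \<odot>\<^bsub>A\<^esub> b"
    using bA by (rule add_pow_eq_smult)
  finally show ?thesis
    using bA order_unit inv_order_closed
    by (simp add: reynolds_def smult_assoc1[symmetric] Units_closed)
qed

lemma reynolds_add:
  assumes "a \<in> carrier A" "b \<in> carrier A"
  shows "reynolds (a \<oplus>\<^bsub>A\<^esub> b) = reynolds a \<oplus>\<^bsub>A\<^esub> reynolds b"
proof -
  have "(\<Oplus>\<^bsub>A\<^esub>g\<in>carrier G. \<phi> g (a \<oplus>\<^bsub>A\<^esub> b)) = (\<Oplus>\<^bsub>A\<^esub>g\<in>carrier G. \<phi> g a \<oplus>\<^bsub>A\<^esub> \<phi> g b)"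
    using assms by (intro M.finsum_cong') (auto simp: action_add action_closed)
  also have "\<dots> = (\<Oplus>\<^bsub>A\<^esub>g\<in>carrier G. \<phi> g a) \<oplus>\<^bsub>A\<^esub> (\<Oplus>\<^bsub>A\<^esub>g\<in>carrier G. \<phi> g b)"
    using assms by (intro M.finsum_addf) (auto simp: action_closed)
  finally show ?thesis
    using assms by (simp add: reynolds_def smult_r_distr inv_order_closed orbit_sum_closed)
qed

lemma reynolds_smult:
  assumes "r \<in> carrier K" "a \<in> carrier A"
  shows "reynolds (r \<odot>\<^bsub>A\<^esub> a) = r \<odot>\<^bsub>A\<^esub> reynolds a"
proof -
  have "(\<Oplus>\<^bsub>A\<^esub>g\<in>carrier G. \<phi> g (r \<odot>\<^bsub>A\<^esub> a)) = (\<Oplus>\<^bsub>A\<^esub>g\<in>carrier G. r \<odot>\<^bsub>A\<^esub> \<phi> g a)"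
    using assms by (intro M.finsum_cong') (auto simp: action_smult action_closed)
  also have "\<dots> = r \<odot>\<^bsub>A\<^esub> (\<Oplus>\<^bsub>A\<^esub>g\<in>carrier G. \<phi> g a)"
    using assms by (intro finsum_smult_ldistr[symmetric]) (auto simp: action_closed finite_G)
  finally show ?thesis
    using assms inv_order_closed orbit_sum_closed
    by (simp add: reynolds_def smult_assoc1[symmetric] m_comm)
qed

text \<open>As \<open>b\<close> is fixed by the action, it factors out of every summand on the
  right. This is the property that makes \<open>\<triangleright>\<close> trivial.\<close>

lemma reynolds_mult:
  assumes "a \<in> carrier A" "b \<in> invariants G \<phi> A"
  shows "reynolds (a \<otimes>\<^bsub>A\<^esub> b) = reynolds a \<otimes>\<^bsub>A\<^esub> b"
proof -
  have b: "b \<in> carrier A" "\<And>g. g \<in> carrier G \<Longrightarrow> \<phi> g b = b"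
    using assms(2) by (auto simp: invariants_def)
  have "(\<Oplus>\<^bsub>A\<^esub>g\<in>carrier G. \<phi> g (a \<otimes>\<^bsub>A\<^esub> b)) = (\<Oplus>\<^bsub>A\<^esub>g\<in>carrier G. \<phi> g a \<otimes>\<^bsub>A\<^esub> b)"
    using assms(1) b by (intro M.finsum_cong') (auto simp: action_mult action_closed jmult_closed)
  also have "\<dots> = (\<Oplus>\<^bsub>A\<^esub>g\<in>carrier G. \<phi> g a) \<otimes>\<^bsub>A\<^esub> b"
    using assms(1) b finite_G
    by (intro M.additive_finsum[where u = "\<lambda>x. x \<otimes>\<^bsub>A\<^esub> b", symmetric])
      (auto simp: action_closed jmult_closed jmult_l_distr)
  finally show ?thesis
    using assms(1) b by (simp add: reynolds_def jmult_smult_l inv_order_closed orbit_sum_closed)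
qed

end

theorem theorem2p19:
  fixes K :: "('k, 'm) ring_scheme"
    and G :: "('g, 'q) monoid_scheme"
    and A :: "('k, 'a, 'n) module_scheme"
    and \<phi> :: "'g \<Rightarrow> 'a \<Rightarrow> 'a"
    and V :: "'a set"
  assumes "field K"
    and "ring_characteristic K \<noteq> 2"
    and "group G"
    and "finite (carrier G)"
    and "[order G] \<cdot>\<^bsub>K\<^esub> \<one>\<^bsub>K\<^esub> \<in> Units K"
    and "jordan_algebra K A"
    and "\<phi> \<in> hom G (Jordan_AutoGroup K A)"
    and "is_complement K A (invariants G \<phi> A) V"
  shows "\<exists>ra la f mV.
      jordan_extending_structure K (A\<lparr>carrier := invariants G \<phi> A\<rparr>) (A\<lparr>carrier := V\<rparr>) ra la f mV \<and>
      (\<forall>x\<in>V. \<forall>b\<in>invariants G \<phi> A. la x b = \<zero>\<^bsub>A\<^esub>) \<and>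
      jordan_iso K A
        (twisted_product (A\<lparr>carrier := invariants G \<phi> A\<rparr>) (A\<lparr>carrier := V\<rparr>) ra f mV) \<noteq> {}"
proof -
  interpret jordan_action K A G \<phi>
    using assms(3-7) by (intro jordan_action.intro jordan_action_axioms.intro)
  show ?thesis
    by (rule twisted_product_of_retraction[OF submodule_invariants invariants_mult_closed assms(8)
          reynolds_closed reynolds_id reynolds_add reynolds_smult reynolds_mult])
qed

end
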